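(* Let $\mathbb{V}_h\subset\mathbb{V}$ be a closed subspace, let $T>0$, and let $u_h:[0,T]\to\mathbb{V}_h$ be a smooth solution of the discrete variational principle $$\langle\mathcal{Q}(u_h(t))^*\,\partial_t u_h(t),v_h\rangle_{\mathbb{V}^*\times\mathbb{V}}=\langle\mathcal{A}(u_h(t)),v_h\rangle_{\mathbb{V}^*\times\mathbb{V}}\qquad\text{for all }v_h\in\mathbb{V}_h,\ 0<t\le T,$$ where smooth means that $u_h$ is continuous in $t$ with respect to the norm of $\mathbb{V}$, continuously differentiable in $t$ with respect to the norm of $\mathbb{W}^*$, and $u_h(t)\in\mathrm{dom}(\mathcal{A})\cap\mathrm{dom}(\mathcal{E})$ for all $t$ (in particular $u_h(0)\in\mathrm{dom}(\mathcal{E})$). Then $$\frac{d}{dt}\mathcal{E}(u_h(t))=-\mathcal{D}(u_h(t))\qquad\text{for all }0<t\le T$$ (at $t=T$ the derivatives are understood as left-sided).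
   Context: Function spaces: $\mathbb{H}$ is a real Hilbert space with scalar product $\langle\cdot,\cdot\rangle$, identified with its dual $\mathbb{H}^*$. $\mathbb{V},\mathbb{W}\subset\mathbb{H}$ are reflexive Banach spaces, continuously and densely embedded in $\mathbb{H}$. Thus $\mathbb{V}\subset\mathbb{H}\subset\mathbb{V}^*$ and $\mathbb{W}\subset\mathbb{H}\subset\mathbb{W}^*$ are evolution triples with the same pivot space. In particular $\mathbb{V}\subset\mathbb{W}^*$, where $v\in\mathbb{V}$ is identified with the functional $w\mapsto\langle v,w\rangle$ on $\mathbb{W}$. Duality pairings are written $\langle\cdot,\cdot\rangle_{\mathbb{V}^*\times\mathbb{V}}$ and $\langle\cdot,\cdot\rangle_{\mathbb{W}^*\times\mathbb{W}}$. Energy: $\mathcal{E}:\mathbb{V}\to\mathbb{R}\cup\{+\infty\}$ is convex and proper, with essential domain $\mathrm{dom}(\mathcal{E})=\{u\in\mathbb{V}:\mathcal{E}(u)<\infty\}$. It is differentiable on its domain with respect to the topology of $\mathbb{W}^*$: for every $u\in\mathrm{dom}(\mathcal{E})$ there is a derivative $\mathcal{E}'(u)\in\mathbb{W}^{**}=\mathbb{W}$ such that $\mathcal{E}(v)=\mathcal{E}(u)+\langle v-u,\mathcal{E}'(u)\rangle_{\mathbb{W}^*\times\mathbb{W}}+o(\|v-u\|_{\mathbb{W}^*})$ as $v\to u$ in $\mathbb{W}^*$, $v\in\mathrm{dom}(\mathcal{E})$. Structural assumption: for every $u\in\mathrm{dom}(\mathcal{E})$ there is a given bounded linear operator $\mathcal{Q}(u):\mathbb{V}\to\mathbb{W}$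 such that $\mathcal{E}'(u)=\mathcal{Q}(u)u$. The adjoint $\mathcal{Q}(u)^*:\mathbb{W}^*\to\mathbb{V}^*$ is the bounded linear operator defined by $\langle\mathcal{Q}(u)^*w^*,v\rangle_{\mathbb{V}^*\times\mathbb{V}}=\langle w^*,\mathcal{Q}(u)v\rangle_{\mathbb{W}^*\times\mathbb{W}}$ for all $v\in\mathbb{V}$, $w^*\in\mathbb{W}^*$. Evolution operator and dissipation: $\mathcal{A}$ is a (possibly nonlinear) densely defined operator from $\mathrm{dom}(\mathcal{A})\subset\mathbb{V}$ to $\mathbb{V}^*$, and the dissipation functional is $\mathcal{D}(u):=-\langle\mathcal{A}(u),u\rangle_{\mathbb{V}^*\times\mathbb{V}}$ for $u\in\mathrm{dom}(\mathcal{A})$. No sign condition on $\mathcal{D}$ is assumed. *)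

theory Defs
  imports "HOL-Analysis.Analysis" "HOL-Library.Landau_Symbols"
begin

text \<open>
  The dual of a normed space \<open>'a\<close> is \<open>'a \<Rightarrow>\<^sub>L real\<close>; the duality pairing of \<open>f\<close> and \<open>x\<close> is
  \<open>blinfun_apply f x\<close>.  The spaces V, W, H are types, and the inclusions of V and W in H
  are bounded linear injections with dense range.
\<close>

text \<open>Reflexivity means that the canonical map into the bidual is onto.\<close>

definition reflexive_space :: "'a::banach itself \<Rightarrow> bool" where
  "reflexive_space _ \<longleftrightarrow>
     (\<forall>\<phi> :: ('a \<Rightarrow>\<^sub>L real) \<Rightarrow>\<^sub>L real. \<exists>x::'a. \<forall>f :: 'a \<Rightarrow>\<^sub>L real.
        blinfun_apply \<phi> f = blinfun_apply f x)"

definition dense_embedding :: "('a::real_normed_vector \<Rightarrow>\<^sub>L 'h::real_normed_vector) \<Rightarrow> bool" where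
  "dense_embedding i \<longleftrightarrow>
     inj (blinfun_apply i) \<and> closure (range (blinfun_apply i)) = UNIV"

text \<open>The inclusion of V in the dual of W, sending \<open>v\<close> to the functional \<open>\<lambda>w. iV v \<bullet> iW w\<close>.\<close>

definition to_dual ::
  "('v::real_normed_vector \<Rightarrow>\<^sub>L 'h::real_inner) \<Rightarrow> ('w::real_normed_vector \<Rightarrow>\<^sub>L 'h) \<Rightarrow> 'v \<Rightarrow> ('w \<Rightarrow>\<^sub>L real)"
  where "to_dual iV iW v = blinfun_inner_right (blinfun_apply iV v) o\<^sub>L iW"

lemma to_dual_apply: "blinfun_apply (to_dual iV iW v) w = iV v \<bullet> iW w"
  by (simp add: to_dual_def)

lift_definition adjoint_op ::
  "('v::real_normed_vector \<Rightarrow>\<^sub>L 'w::real_normed_vector) \<Rightarrow> (('w \<Rightarrow>\<^sub>L real) \<Rightarrow>\<^sub>L ('v \<Rightarrow>\<^sub>L real))"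
  is "\<lambda>Q f. f o\<^sub>L Q"
  by (rule bounded_bilinear.bounded_linear_left[OF bounded_bilinear_blinfun_compose])

lemma adjoint_op_apply:
  "blinfun_apply (blinfun_apply (adjoint_op Q) f) v = blinfun_apply f (blinfun_apply Q v)"
  by (simp add: adjoint_op.rep_eq)

definition ess_dom :: "('v \<Rightarrow> ereal) \<Rightarrow> 'v set" where
  "ess_dom E = {u. E u < \<infinity>}"

definition proper_fun :: "('v \<Rightarrow> ereal) \<Rightarrow> bool" where
  "proper_fun E \<longleftrightarrow> (\<forall>u. E u \<noteq> -\<infinity>) \<and> ess_dom E \<noteq> {}"

definition convex_ereal :: "('v::real_vector \<Rightarrow> ereal) \<Rightarrow> bool" where
  "convex_ereal E \<longleftrightarrow>
     (\<forall>u v. \<forall>t\<in>{0..1}. E ((1 - t) *\<^sub>R u + t *\<^sub>R v) \<le> ereal (1 - t) * E u + ereal t * E v)"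

text \<open>
  \<open>d\<close>, an element of W identified with its bidual, is a derivative of \<open>E\<close> at \<open>u\<close> with respect
  to the norm of the dual of W.  The filter describes \<open>v \<rightarrow> u\<close> in that norm
  with \<open>v\<close> restricted to the essential domain, on which the conversion to \<open>real\<close> is faithful
  for a proper \<open>E\<close>.
\<close>

definition has_dual_derivative ::
  "('v::real_normed_vector \<Rightarrow>\<^sub>L 'h::real_inner) \<Rightarrow> ('w::real_normed_vector \<Rightarrow>\<^sub>L 'h) \<Rightarrow>
   ('v \<Rightarrow> ereal) \<Rightarrow> 'w \<Rightarrow> 'v \<Rightarrow> bool" where
  "has_dual_derivative iV iW E d u \<longleftrightarrow>
     (\<lambda>v. real_of_ereal (E v) - real_of_ereal (E u) - blinfun_apply (to_dual iV iW (v - u)) d)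
       \<in> o[inf (filtercomap (to_dual iV iW) (nhds (to_dual iV iW u))) (principal (ess_dom E))](
         \<lambda>v. norm (to_dual iV iW (v - u)))"

definition dissipation :: "('v::real_normed_vector \<Rightarrow> ('v \<Rightarrow>\<^sub>L real)) \<Rightarrow> 'v \<Rightarrow> real" where
  "dissipation A u = - blinfun_apply (A u) u"

end

theory Submission
  imports Defs
begin

text \<open>Writing J for the embedding of V into the dual of W, the energy identity is the chain of
  equalities d/dt E(u) = <(J u)', E'(u)> = <(J u)', Q(u) u> = <Q(u)^* (J u)', u> = <A(u), u> =
  -D(u). The structure E'(u) = Q(u) u turns the energy derivative into the left side of the scheme
  tested with u(t) itself, which is admissible because u(t) lies in \<open>Vh\<close>. The analytic
  content is the first equality, \<open>has_dual_derivative_chain\<close>: the curve and the energy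
  are differentiable with respect to the same norm, that of the dual of W.\<close>

lemma to_dual_diff: "to_dual iV iW (x - y) = to_dual iV iW x - to_dual iV iW y"
  by (rule blinfun_eqI) (simp add: to_dual_apply blinfun.diff_left blinfun.diff_right inner_diff_left)

text \<open>A differentiable curve satisfies a linear growth bound at t. This turns a remainder that
  is small relative to the increment of the curve into one that is small relative to s - t.\<close>

lemma has_vector_derivative_imp_bigo:
  fixes g :: "real \<Rightarrow> 'a::real_normed_vector"
  assumes "(g has_vector_derivative g') (at t within S)"
  shows "(\<lambda>s. norm (g s - g t)) \<in> O[at t within S](\<lambda>s. s - t)"
proof -
  \<comment> \<open>The epsilon in the definition of the derivative is taken to be 1, which gives
    the constant \<open>1 + norm g'\<close> below.\<close>
  have "eventually (\<lambda>s. norm (g s - g t - (s - t) *\<^sub>R g') \<le> 1 * norm (s - t)) (at t within S)"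
    using assms unfolding has_vector_derivative_def has_derivative_within_alt2
    using zero_less_one by blast
  then have "eventually (\<lambda>s. norm (norm (g s - g t)) \<le> (1 + norm g') * norm (s - t)) (at t within S)"
  proof eventually_elim
    case (elim s)
    have "norm (g s - g t) \<le> norm (g s - g t - (s - t) *\<^sub>R g') + norm ((s - t) *\<^sub>R g')"
      using norm_triangle_sub[of "g s - g t" "(s - t) *\<^sub>R g'"] by simp
    also have "\<dots> \<le> (1 + norm g') * norm (s - t)"
      using elim by (simp add: distrib_right mult.commute[of "norm g'"])
    finally show ?case
      by simp
  qed
  then show ?thesis
    by (rule bigoI)
qed

lemma has_real_derivative_zero_if_smallo:
  fixes r :: "real \<Rightarrow> real"
  assumes "r \<in> o[at t within S](\<lambda>s. s - t)" and "r t = 0"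
  shows "(r has_real_derivative 0) (at t within S)"
  using smalloD_tendsto[OF assms(1)] assms(2)
  by (simp add: has_field_derivative_iff)

text \<open>The energy along the curve is a remainder plus a bounded linear functional of J u plus a
  constant. The remainder has derivative 0 at t, so only the linear part contributes.\<close>

lemma has_dual_derivative_chain:
  fixes iV :: "'v::real_normed_vector \<Rightarrow>\<^sub>L 'h::real_inner"
    and iW :: "'w::real_normed_vector \<Rightarrow>\<^sub>L 'h"
  assumes E: "has_dual_derivative iV iW E d (u t)"
    and dom: "\<And>s. s \<in> S \<Longrightarrow> u s \<in> ess_dom E"
    and g: "((\<lambda>s. to_dual iV iW (u s)) has_vector_derivative g') (at t within S)"
  shows "((\<lambda>s. real_of_ereal (E (u s))) has_real_derivative blinfun_apply g' d) (at t within S)"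
proof -
  let ?J = "to_dual iV iW"
  define r where
    "r v = real_of_ereal (E v) - real_of_ereal (E (u t)) - blinfun_apply (?J (v - u t)) d" for v
  \<comment> \<open>The filter in \<open>has_dual_derivative\<close> is an infimum, so convergence
    of \<open>u\<close> along it splits into continuity in the dual norm and membership in the
    essential domain.\<close>
  have "((\<lambda>s. ?J (u s)) \<longlongrightarrow> ?J (u t)) (at t within S)"
    using has_vector_derivative_continuous[OF g] by (simp add: continuous_within)
  moreover have "eventually (\<lambda>s. u s \<in> ess_dom E) (at t within S)"
    using dom by (simp add: eventually_at_filter)
  ultimately have "filterlim u
      (inf (filtercomap ?J (nhds (?J (u t)))) (principal (ess_dom E))) (at t within S)"
    by (simp add: filterlim_inf filterlim_principal filterlim_filtercomap_iff o_def)
  \<comment> \<open>The little-o expansion of \<open>E\<close> is pulled back along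
    \<open>u\<close>.\<close>
  then have "(\<lambda>s. r (u s)) \<in> o[at t within S](\<lambda>s. norm (?J (u s - u t)))"
    using E unfolding has_dual_derivative_def r_def[symmetric]
    by (rule landau_o.small.compose[rotated])
  also have "(\<lambda>s. norm (?J (u s - u t))) \<in> O[at t within S](\<lambda>s. s - t)"
    using has_vector_derivative_imp_bigo[OF g] by (simp add: to_dual_diff)
  finally have "((\<lambda>s. r (u s)) has_real_derivative 0) (at t within S)"
    by (rule has_real_derivative_zero_if_smallo) (simp add: r_def to_dual_apply blinfun.zero_right)
  moreover have "((\<lambda>s. blinfun_apply (?J (u s)) d) has_real_derivative blinfun_apply g' d)
      (at t within S)"
    using bounded_linear.has_vector_derivative[OF blinfun.bounded_linear_left g]
    by (simp add: has_real_derivative_iff_has_vector_derivative)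
  \<comment> \<open>By linearity of J, the added constant makes the sum equal to the energy at
    \<open>u s\<close>.\<close>
  ultimately have "((\<lambda>s. r (u s) + blinfun_apply (?J (u s)) d
        + (real_of_ereal (E (u t)) - blinfun_apply (?J (u t)) d))
      has_real_derivative 0 + blinfun_apply g' d + 0) (at t within S)"
    by (intro DERIV_add DERIV_const)
  then show ?thesis
    by (simp add: r_def to_dual_diff blinfun.diff_left)
qed

theorem theorem2:
  fixes iV :: "'v::banach \<Rightarrow>\<^sub>L 'h::{real_inner, complete_space}"
    and iW :: "'w::banach \<Rightarrow>\<^sub>L 'h"
    and E :: "'v \<Rightarrow> ereal"
    and dE :: "'v \<Rightarrow> 'w"
    and Q :: "'v \<Rightarrow> ('v \<Rightarrow>\<^sub>L 'w)"
    and domA :: "'v set"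
    and A :: "'v \<Rightarrow> ('v \<Rightarrow>\<^sub>L real)"
    and Vh :: "'v set"
    and T :: real
    and u :: "real \<Rightarrow> 'v"
    and du :: "real \<Rightarrow> ('w \<Rightarrow>\<^sub>L real)"
  assumes "reflexive_space TYPE('v)" and "reflexive_space TYPE('w)"
    and "dense_embedding iV" and "dense_embedding iW"
    and "convex_ereal E" and "proper_fun E"
    and "\<forall>z\<in>ess_dom E. has_dual_derivative iV iW E (dE z) z"
    and "\<forall>z\<in>ess_dom E. dE z = blinfun_apply (Q z) z"
    and "closure domA = UNIV"
    and "subspace Vh" and "closed Vh"
    and "T > 0"
    and "\<forall>t\<in>{0..T}. u t \<in> Vh"
    and "\<forall>t\<in>{0..T}. u t \<in> domA \<inter> ess_dom E"
    and "continuous_on {0..T} u"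
    and "\<forall>t\<in>{0<..T}.
           ((\<lambda>s. to_dual iV iW (u s)) has_vector_derivative du t) (at t within {0..T})"
    and "continuous_on {0<..T} du"
    and "\<forall>t\<in>{0<..T}. \<forall>vh\<in>Vh.
           blinfun_apply (blinfun_apply (adjoint_op (Q (u t))) (du t)) vh
             = blinfun_apply (A (u t)) vh"
  shows "\<forall>t\<in>{0<..T}.
           ((\<lambda>s. real_of_ereal (E (u s))) has_real_derivative - dissipation A (u t))
             (at t within {0..T})"
proof
  fix t assume t: "t \<in> {0<..T}"
  then have dom: "u t \<in> ess_dom E" and Vh: "u t \<in> Vh"
    using assms(13,14) by auto
  \<comment> \<open>Relative to \<open>{0..T}\<close> the derivative is two-sided for t < T and
    left-sided at t = T.\<close>
  have "((\<lambda>s. real_of_ereal (E (u s))) has_real_derivative blinfun_apply (du t) (dE (u t)))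
      (at t within {0..T})"
    using assms(7,14,16) t dom by (intro has_dual_derivative_chain) auto
  moreover have "blinfun_apply (du t) (dE (u t)) = - dissipation A (u t)"
    \<comment> \<open>the scheme tested with \<open>v\<^sub>h = u\<^sub>h(t)\<close>\<close>
    using assms(8,18) t dom Vh by (auto simp: dissipation_def adjoint_op_apply)
  ultimately show "((\<lambda>s. real_of_ereal (E (u s))) has_real_derivative - dissipation A (u t))
      (at t within {0..T})"
    by simp
qed

end
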